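(* Consider the system $x(k+1)=Ax(k)+B_1u_1(k)+B_2u_2(k)$, $y_i(k)=H_ix(k)$ ($i=1,2$), with $P_1,P_2,K_1,K_2$ as defined in the context. Assume that $(A,B)$ with $B=[B_1\ \ B_2]$ is stabilizable and that $(A,Q_i)$ is observable for $i=1,2$. Suppose the gain matrices $L_1,L_2$ are such that the matrix $$\mathcal{A}=\begin{bmatrix}A+B_2K_2-L_1H_1 & -B_2K_2\\ -B_1K_1 & A+B_1K_1-L_2H_2\end{bmatrix}$$ is stable. Then the costs $J_i^\star(s,\infty)$ under the observer-feedback Stackelberg strategy $u_1(k)=u_1^\star(k)=K_1\hat x_1(k)$, $u_2(k)=u_2^\star(k)=K_2\hat x_2(k)$ are asymptotically optimal with respect to the optimal costs $J_i^*(s,\infty)=x'(s)P_ix(s)$ of the optimal feedback Stackelberg strategy $u_1(k)=K_1x(k)$, $u_2(k)=K_2x(k)$; that is, for any $\varepsilon>0$ there exists a sufficiently large integer $N$ such that, for $i=1,2$, $$\delta J_i(N,\infty)=J_i^\star(N,\infty)-J_i^*(N,\infty)<\varepsilon .$$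
   Context: System: $x(k)\in\mathbb{R}^n$ is the state with initial value $x(0)$; $u_1(k)\in\mathbb{R}^{m_1}$ is the control input of the follower, $u_2(k)\in\mathbb{R}^{m_2}$ that of the leader; $y_i(k)\in\mathbb{R}^{s_i}$ are measurements; $A,B_i,H_i$ are constant real matrices of compatible dimensions; $k=0,1,2,\dots$. A prime denotes transpose. A square matrix is called stable if all its eigenvalues lie strictly inside the unit circle. Weights: symmetric matrices $Q_i\ge 0$, $R_{ij}\ge0$ ($i\ne j$), $R_{ii}>0$ ($i,j=1,2$) of compatible dimensions. Costs: for $0\le s\le M$, $J_i(s,M)=\sum_{k=s}^{M}[x'(k)Q_ix(k)+u_1'(k)R_{i1}u_1(k)+u_2'(k)R_{i2}u_2(k)]$, $i=1,2$ ($i=1$ follower, $i=2$ leader), and $J_i(s,\infty)=\lim_{M\to\infty}J_i(s,M)$. $J_i^\star(s,\infty)$ denotes $J_i(s,\infty)$ evaluated along the closed loop with the observer-feedback strategy. In $J_i^*(s,\infty)=x'(s)P_ix(s)$ (the optimal cost from time $s$ and state $x(s)$ under the optimal feedback Stackelberg strategy with perfect state information), as it enters $\delta J_i(s,\infty)$, $x(s)$ is the state at time $s$ of the closed loop under the observer-feedback strategy. Gains: $P_1>0$, $P_2>0$ (symmetric) together with $K_1,K_2$ satisfy $K_1=-\Gamma_1^{-1}Y_1$, $K_2=-\Gamma_2^{-1}Y_2$, where $\Gamma_1=R_{11}+B_1'P_1B_1$, $S=\Gamma_1^{-1}B_1'P_1$, $M_1=I-B_1S$, $\Gamma_2=R_{22}+B_2'M_1'P_2M_1B_2+B_2'S'R_{21}SB_2$,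 $Y_1=B_1'P_1A+B_1'P_1B_2K_2$, $Y_2=B_2'M_1'P_2M_1A+B_2'S'R_{21}SA$, and the coupled algebraic Riccati equations $P_1=Q_1+(A+B_2K_2)'P_1(A+B_2K_2)-Y_1'\Gamma_1^{-1}Y_1+K_2'R_{12}K_2$, $P_2=Q_2+A'M_1'P_2M_1A+A'S'R_{21}SA-Y_2'\Gamma_2^{-1}Y_2$. Observers (with arbitrary initial values $\hat x_1(0),\hat x_2(0)\in\mathbb{R}^n$): $\hat x_1(k+1)=A\hat x_1(k)+B_1u_1^\star(k)+B_2K_2\hat x_1(k)+L_1[y_1(k)-H_1\hat x_1(k)]$, $\hat x_2(k+1)=A\hat x_2(k)+B_1K_1\hat x_2(k)+B_2u_2^\star(k)+L_2[y_2(k)-H_2\hat x_2(k)]$. *)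

theory Defs
  imports "HOL-Analysis.Analysis"
begin

definition psd_matrix :: "real^'n^'n \<Rightarrow> bool" where
  "psd_matrix A \<longleftrightarrow> transpose A = A \<and> (\<forall>x. 0 \<le> x \<bullet> (A *v x))"

definition pd_matrix :: "real^'n^'n \<Rightarrow> bool" where
  "pd_matrix A \<longleftrightarrow> transpose A = A \<and> (\<forall>x. x \<noteq> 0 \<longrightarrow> 0 < x \<bullet> (A *v x))"

text \<open>Eigenvalues of a real matrix are taken over the complex numbers.\<close>

definition eigenvalue_of :: "real^'n^'n \<Rightarrow> complex \<Rightarrow> bool" where
  "eigenvalue_of A c \<longleftrightarrow> (\<exists>v. v \<noteq> 0 \<and> map_matrix complex_of_real A *v v = c *s v)"

definition stable_matrix :: "real^'n^'n \<Rightarrow> bool" where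
  "stable_matrix A \<longleftrightarrow> (\<forall>c. eigenvalue_of A c \<longrightarrow> cmod c < 1)"

definition hcat :: "real^'a^'n \<Rightarrow> real^'b^'n \<Rightarrow> real^('a + 'b)^'n" where
  "hcat B C = (\<chi> i j. case j of Inl a \<Rightarrow> B $ i $ a | Inr b \<Rightarrow> C $ i $ b)"

definition vcat :: "real^'n^'a \<Rightarrow> real^'n^'b \<Rightarrow> real^'n^('a + 'b)" where
  "vcat B C = (\<chi> i. case i of Inl a \<Rightarrow> B $ a | Inr b \<Rightarrow> C $ b)"

definition block_matrix ::
  "real^'a^'c \<Rightarrow> real^'b^'c \<Rightarrow> real^'a^'d \<Rightarrow> real^'b^'d \<Rightarrow> real^('a + 'b)^('c + 'd)" where
  "block_matrix A B C D = vcat (hcat A B) (hcat C D)"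

definition stabilizable :: "real^'n^'n \<Rightarrow> real^'m^'n \<Rightarrow> bool" where
  "stabilizable A B \<longleftrightarrow> (\<exists>K. stable_matrix (A + B ** K))"

text \<open>The outputs \<open>C A\<^sup>k x\<^sub>0\<close> of the autonomous system determine the initial state \<open>x\<^sub>0\<close>.
  The iterate of \<open>(*v) A\<close> is used because \<open>^\<close> on this matrix type would be the componentwise
  power.\<close>

definition observable :: "real^'n^'n \<Rightarrow> real^'n^'s \<Rightarrow> bool" where
  "observable A C \<longleftrightarrow>
     (\<forall>x z. (\<forall>k. C *v (((*v) A ^^ k) x) = C *v (((*v) A ^^ k) z)) \<longrightarrow> x = z)"

definition cost ::
  "real^'n^'n \<Rightarrow> real^'a^'a \<Rightarrow> real^'b^'b \<Rightarrow>
   (nat \<Rightarrow> real^'n) \<Rightarrow> (nat \<Rightarrow> real^'a) \<Rightarrow> (nat \<Rightarrow> real^'b) \<Rightarrow> nat \<Rightarrow> nat \<Rightarrow> real" where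
  "cost Q Ra Rb x u v s M =
     (\<Sum>k=s..M. x k \<bullet> (Q *v x k) + u k \<bullet> (Ra *v u k) + v k \<bullet> (Rb *v v k))"

text \<open>\<open>lim\<close> is unspecified for divergent sequences, so statements about \<open>cost_inf\<close> should
  come with convergence of the finite-horizon costs.\<close>

definition cost_inf ::
  "real^'n^'n \<Rightarrow> real^'a^'a \<Rightarrow> real^'b^'b \<Rightarrow>
   (nat \<Rightarrow> real^'n) \<Rightarrow> (nat \<Rightarrow> real^'a) \<Rightarrow> (nat \<Rightarrow> real^'b) \<Rightarrow> nat \<Rightarrow> real" where
  "cost_inf Q Ra Rb x u v s = lim (\<lambda>M. cost Q Ra Rb x u v s M)"

end

theory Submission
  imports "HOL-Computational_Algebra.Fundamental_Theorem_Algebra" Defs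
begin

text \<open>The state together with the observer errors \<open>x - xh1\<close>, \<open>x - xh2\<close> forms an autonomous linear
  system with a block triangular matrix whose diagonal blocks are the ideal closed loop
  \<open>A + B1 K1 + B2 K2\<close> and the error matrix of the hypothesis. The sum of the two Riccati equations
  is a Lyapunov equation for the ideal closed loop with Lyapunov matrix \<open>P1 + P2\<close>. The sum is
  needed: each equation alone weights one of the two inputs only semidefinitely, so it does not
  give access to observability of \<open>A\<close>. Hence the whole system is stable, state and inputs are
  summable, the costs converge, and their tails vanish, while \<open>x N \<bullet> P x N\<close> is nonnegative.

  That the orbits of a stable matrix are summable is proved without normal forms: an orbit is
  annihilated by a polynomial, which is split into linear factors over the complex numbers.\<close>

section \<open>Polynomials in a matrix, acting on a vector\<close>

text \<open>This is p(C) z by Horner's scheme; folding over vectors forms no powers of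
  matrices.\<close>

definition poly_apply :: "complex^'n^'n \<Rightarrow> complex poly \<Rightarrow> complex^'n \<Rightarrow> complex^'n" where
  "poly_apply C p z = fold_coeffs (\<lambda>a w. a *s z + C *v w) p 0"

lemma poly_apply_0 [simp]: "poly_apply C 0 z = 0"
  by (simp add: poly_apply_def)

lemma poly_apply_pCons [simp]:
  "poly_apply C (pCons a p) z = a *s z + C *v poly_apply C p z"
proof (cases "p = 0 \<and> a = 0")
  case False
  then show ?thesis
    by (auto simp: poly_apply_def fold_coeffs_pCons_not_0_0_eq fold_coeffs_pCons_coeff_not_0_eq)
qed simp

lemma poly_apply_add: "poly_apply C (p + q) z = poly_apply C p z + poly_apply C q z"
  by (induction p q rule: poly_induct2)
    (simp_all add: vec.scale_left_distrib matrix_vector_right_distrib)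

lemma poly_apply_smult: "poly_apply C (smult c p) z = c *s poly_apply C p z"
  by (induction p) (simp_all add: vec.scale_right_distrib vector_scalar_commute)

lemma poly_apply_sum: "poly_apply C (sum p I) z = (\<Sum>i\<in>I. poly_apply C (p i) z)"
  by (induction I rule: infinite_finite_induct) (simp_all add: poly_apply_add)

lemma poly_apply_monom: "poly_apply C (monom c k) z = c *s (((*v) C ^^ k) z)"
  by (induction k) (simp_all add: monom_0 monom_Suc vector_scalar_commute)

lemma poly_apply_linear_factor:
  "poly_apply C ([:- \<mu>, 1:] * q) z = C *v poly_apply C q z - \<mu> *s poly_apply C q z"
proof -
  have "[:- \<mu>, 1:] * q = pCons 0 q + smult (- \<mu>) q"
    by simp
  then show ?thesis
    by (simp only: poly_apply_add poly_apply_smult poly_apply_pCons) simp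
qed

text \<open>\<open>C\<close> commutes with q(C), so the factor may act on \<open>z\<close> first.
  This form passes annihilation by \<open>p\<close> to a new starting vector; the other one exhibits
  q(C) z as an eigenvector candidate.\<close>

lemma poly_apply_linear_factor':
  "poly_apply C ([:- \<mu>, 1:] * q) z = poly_apply C q (C *v z - \<mu> *s z)"
proof -
  have "poly_apply C q (C *v z - \<mu> *s z) = C *v poly_apply C q z - \<mu> *s poly_apply C q z"
  proof (induction q)
    case (pCons a q)
    show ?case
      by (simp only: poly_apply_pCons pCons.IH)
        (simp add: vec.scale_right_distrib vec.scale_right_diff_distrib vector_scalar_commute
          matrix_vector_mult_diff_distrib matrix_vector_right_distrib algebra_simps)
  qed simp
  then show ?thesis
    by (simp only: poly_apply_linear_factor)
qed

text \<open>The d+1 vectors z, ..., C^d z in dimension d are dependent. A dependence speaks of a set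
  of vectors, so it yields coefficients by exponent only if they are distinct; a repetition C^i z =
  C^j z gives X^i - X^j directly.\<close>

lemma annihilating_poly_exists:
  fixes C :: "complex^'n^'n"
  shows "\<exists>p. p \<noteq> 0 \<and> poly_apply C p z = 0"
proof -
  define orb where "orb k = ((*v) C ^^ k) z" for k
  define d where "d = CARD('n)"
  show ?thesis
  proof (cases "inj_on orb {..d}")
    case True
    then have "card (orb ` {..d}) = Suc d"
      by (simp add: card_image)
    moreover have "vec.dim (orb ` {..d}) \<le> d"
      unfolding d_def by (rule dim_subset_UNIV_cart_gen)
    ultimately have "vec.dependent (orb ` {..d})"
      by (intro vec.dependent_biggerset_general) simp
    then obtain u j where u: "j \<le> d" "u (orb j) \<noteq> 0" "(\<Sum>v\<in>orb ` {..d}. u v *s v) = 0"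
      by (subst (asm) vec.dependent_finite) auto
    define p where "p = (\<Sum>k\<le>d. monom (u (orb k)) k)"
    have "coeff p j = u (orb j)"
      using u(1) by (simp add: p_def coeff_sum)
    moreover have "poly_apply C p z = (\<Sum>k\<le>d. u (orb k) *s orb k)"
      by (simp add: p_def poly_apply_sum poly_apply_monom orb_def)
    ultimately show ?thesis
      using u True by (auto simp: sum.reindex intro!: exI[of _ p])
  next
    case False
    then obtain i j where ij: "i \<noteq> j" "orb i = orb j"
      by (auto simp: inj_on_def)
    let ?p = "monom 1 i + monom (- 1) j :: complex poly"
    have "coeff ?p i \<noteq> 0"
      using ij(1) by simp
    then have "?p \<noteq> 0"
      by (metis coeff_0)
    moreover have "poly_apply C ?p z = 0"
      using ij(2) by (simp add: poly_apply_add poly_apply_monom orb_def)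
    ultimately show ?thesis
      by blast
  qed
qed

section \<open>Summability of the orbits of a stable matrix\<close>

text \<open>Summing the triangle inequality gives s <= |z 0| + |\<mu>| s + (sum of |w|) for each
  partial sum s; as |\<mu>| < 1, this can be solved for s.\<close>

lemma summable_norm_affine_recurrence:
  fixes z w :: "nat \<Rightarrow> complex^'n"
  assumes z: "\<And>k. z (Suc k) = \<mu> *s z k + w k" and "cmod \<mu> < 1"
    and w: "summable (\<lambda>k. norm (w k))"
  shows "summable (\<lambda>k. norm (z k))"
proof (rule bounded_imp_summable)
  have norm_scale: "norm (\<mu> *s v) = cmod \<mu> * norm v" for v :: "complex^'n"
    by (simp add: norm_vec_def norm_mult L2_set_right_distrib)
  have step: "norm (z (Suc k)) \<le> cmod \<mu> * norm (z k) + norm (w k)" for k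
    unfolding z norm_scale[symmetric] by (rule norm_triangle_ineq)
  fix n
  have "(\<Sum>k\<le>n. norm (z k)) \<le> norm (z 0) + (\<Sum>k\<le>n. norm (z (Suc k)))"
    using sum.atMost_Suc_shift[of "\<lambda>k. norm (z k)" n] norm_ge_zero[of "z (Suc n)"]
    unfolding sum.atMost_Suc by linarith
  also have "(\<Sum>k\<le>n. norm (z (Suc k))) \<le> (\<Sum>k\<le>n. cmod \<mu> * norm (z k) + norm (w k))"
    by (intro sum_mono step)
  also have "\<dots> = cmod \<mu> * (\<Sum>k\<le>n. norm (z k)) + (\<Sum>k\<le>n. norm (w k))"
    by (simp add: sum.distrib sum_distrib_left)
  also have "(\<Sum>k\<le>n. norm (w k)) \<le> (\<Sum>k. norm (w k))"
    by (intro sum_le_suminf w) auto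
  finally show "(\<Sum>k\<le>n. norm (z k)) \<le> (norm (z 0) + (\<Sum>k. norm (w k))) / (1 - cmod \<mu>)"
    using \<open>cmod \<mu> < 1\<close> by (simp add: field_simps)
qed simp

lemma summable_norm_orbit_complex:
  fixes C :: "complex^'n^'n"
  assumes eig: "\<And>\<mu> v. v \<noteq> 0 \<Longrightarrow> C *v v = \<mu> *s v \<Longrightarrow> cmod \<mu> < 1"
  shows "summable (\<lambda>k. norm (((*v) C ^^ k) z))"
proof -
  have "summable (\<lambda>k. norm (((*v) C ^^ k) z))" if "p \<noteq> 0" "poly_apply C p z = 0" for p z
    using that
  proof (induction "degree p" arbitrary: p z)
    case 0
    then obtain a where "p = [:a:]" "a \<noteq> 0"
      by (metis degree_eq_zeroE pCons_0_0)
    with 0 have "z = 0"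
      by simp
    moreover have "((*v) C ^^ k) 0 = 0" for k
      by (induction k) simp_all
    ultimately show ?case
      by simp
  next
    case (Suc n)
    then obtain \<mu> where "poly p \<mu> = 0"
      by (metis constant_degree fundamental_theorem_of_algebra nat.distinct(1))
    then obtain q where p: "p = [:- \<mu>, 1:] * q"
      unfolding poly_eq_0_iff_dvd by (elim dvdE)
    with Suc.prems have q: "q \<noteq> 0" "n = degree q"
      using Suc.hyps(2) by (auto simp: degree_mult_eq simp del: mult_pCons_left)
    show ?case
    proof (cases "cmod \<mu> < 1")
      case True
      \<comment> \<open>\<open>?w\<close> is annihilated by the quotient \<open>q\<close>, so its
        orbit is summable by induction, and it drives an affine recurrence with factor \<mu> for the
        orbit of \<open>z\<close>.\<close>
      let ?w = "C *v z - \<mu> *s z"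
      have w: "summable (\<lambda>k. norm (((*v) C ^^ k) ?w))"
        using Suc.hyps(1)[OF q(2,1)] Suc.prems(2) unfolding p poly_apply_linear_factor' by blast
      have "((*v) C ^^ Suc k) z = \<mu> *s ((*v) C ^^ k) z + ((*v) C ^^ k) ?w" for k
        by (induction k) (simp_all add: matrix_vector_right_distrib
            matrix_vector_mult_diff_distrib vector_scalar_commute)
      then show ?thesis
        by (rule summable_norm_affine_recurrence[OF _ True w])
    next
      case False
      \<comment> \<open>Otherwise q(C) z would be an eigenvector for \<mu>, outside the open unit
        disc. So \<open>q\<close> already annihilates \<open>z\<close>.\<close>
      with eig Suc.prems(2) have "poly_apply C q z = 0"
        unfolding p poly_apply_linear_factor by (auto simp: right_minus_eq)
      then show ?thesis
        using Suc.hyps(1)[OF q(2,1)] by blast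
    qed
  qed
  with annihilating_poly_exists[of C z] show ?thesis
    by blast
qed

lemma summable_norm_stable_orbit:
  fixes F :: "real^'n^'n"
  assumes "stable_matrix F" and z: "\<And>k. z (Suc k) = F *v z k"
  shows "summable (\<lambda>k. norm (z k))"
proof -
  let ?C = "map_matrix complex_of_real F"
  define c where "c v = (\<chi> i. complex_of_real (v $ i))" for v :: "real^'n"
  have mult: "c (F *v v) = ?C *v c v" for v
    by (simp add: c_def vec_eq_iff matrix_vector_mult_def map_matrix_def)
  have orbit: "c (z k) = ((*v) ?C ^^ k) (c (z 0))" for k
    by (induction k) (simp_all add: z mult)
  have norm_c: "norm (c v) = norm v" for v
    by (simp add: c_def norm_vec_def)
  have "summable (\<lambda>k. norm (((*v) ?C ^^ k) (c (z 0))))"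
    using assms(1) by (intro summable_norm_orbit_complex)
      (auto simp: stable_matrix_def eigenvalue_of_def)
  then show ?thesis
    unfolding orbit[symmetric] norm_c .
qed

section \<open>Block vectors and block triangular matrices\<close>

definition vjoin :: "'a^'m \<Rightarrow> 'a^'n \<Rightarrow> 'a^('m + 'n)" where
  "vjoin x y = (\<chi> i. case i of Inl a \<Rightarrow> x $ a | Inr b \<Rightarrow> y $ b)"

lemma vjoin_nth [simp]: "vjoin x y $ Inl a = x $ a" "vjoin x y $ Inr b = y $ b"
  by (simp_all add: vjoin_def)

lemma vec_sum_eq_iff:
  fixes v w :: "'a^('m::finite + 'n::finite)"
  shows "v = w \<longleftrightarrow> (\<forall>i. v $ Inl i = w $ Inl i) \<and> (\<forall>j. v $ Inr j = w $ Inr j)"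
  unfolding vec_eq_iff by (metis sum.exhaust)

lemma vjoin_eq_iff [simp]: "vjoin x y = vjoin x' y' \<longleftrightarrow> x = x' \<and> y = y'"
  by (simp add: vec_sum_eq_iff) (simp add: vec_eq_iff)

lemma vjoin_exhaust: obtains x y where "v = vjoin x y"
proof
  show "v = vjoin (\<chi> i. v $ Inl i) (\<chi> j. v $ Inr j)"
    by (simp add: vec_sum_eq_iff)
qed

text \<open>The entrywise map \<open>f\<close> lets one computation serve both the real matrix
  (identity) and its complexification, on which eigenvalues are defined.\<close>

lemma map_block_matrix_mult_vjoin:
  "map_matrix f (block_matrix A B C D) *v vjoin x y =
   vjoin (map_matrix f A *v x + map_matrix f B *v y) (map_matrix f C *v x + map_matrix f D *v y)"
  by (simp add: vec_sum_eq_iff matrix_vector_mult_def map_matrix_def block_matrix_def vcat_def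
      hcat_def sum.Plus comp_def flip: UNIV_Plus_UNIV)

lemma block_matrix_mult_vjoin:
  "block_matrix A B C D *v vjoin x y = vjoin (A *v x + B *v y) (C *v x + D *v y)"
proof -
  have "map_matrix (\<lambda>a. a) X = X" for X :: "real^'e^'f"
    by (simp add: map_matrix_def)
  with map_block_matrix_mult_vjoin[of "\<lambda>a. a" A B C D x y] show ?thesis
    by (simp add: map_matrix_def)
qed

lemma hcat_mult_vjoin: "hcat B C *v vjoin x y = B *v x + C *v y"
  by (simp add: vec_eq_iff matrix_vector_mult_def hcat_def sum.Plus comp_def
      flip: UNIV_Plus_UNIV)

lemma norm_vjoin_ge:
  fixes x :: "real^'m" and y :: "real^'n"
  shows "norm x \<le> norm (vjoin x y)" "norm y \<le> norm (vjoin x y)"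
proof -
  have "vjoin x y \<bullet> vjoin x y = x \<bullet> x + y \<bullet> y"
    by (simp add: inner_vec_def sum.Plus comp_def flip: UNIV_Plus_UNIV)
  then show "norm x \<le> norm (vjoin x y)" "norm y \<le> norm (vjoin x y)"
    by (simp_all add: norm_le)
qed

text \<open>The lower half of an eigenvector is an eigenvector of \<open>D\<close> unless it is
  zero, and then the upper half is one of \<open>A\<close>.\<close>

lemma stable_matrix_block_triangular:
  fixes A :: "real^'m^'m" and D :: "real^'n^'n"
  assumes "stable_matrix A" "stable_matrix D"
  shows "stable_matrix (block_matrix A B 0 D)"
  unfolding stable_matrix_def eigenvalue_of_def
proof (intro allI impI, elim exE conjE)
  fix c v
  assume v: "v \<noteq> 0" "map_matrix complex_of_real (block_matrix A B 0 D) *v v = c *s v"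
  obtain x y where xy: "v = vjoin x y"
    by (rule vjoin_exhaust)
  have scale: "c *s vjoin x y = vjoin (c *s x) (c *s y)"
    by (simp add: vec_sum_eq_iff)
  have zero: "map_matrix complex_of_real (0 :: real^'m^'n) = 0"
    by (simp add: map_matrix_def vec_eq_iff)
  have eq: "map_matrix complex_of_real A *v x + map_matrix complex_of_real B *v y = c *s x"
      "map_matrix complex_of_real D *v y = c *s y"
    using v(2) by (simp_all add: xy map_block_matrix_mult_vjoin scale zero)
  show "cmod c < 1"
  proof (cases "y = 0")
    case True
    moreover from this have "x \<noteq> 0"
      using v(1) xy by (auto simp: vec_sum_eq_iff)
    ultimately show ?thesis
      using eq(1) assms(1) by (auto simp: stable_matrix_def eigenvalue_of_def)
  next
    case False
    then show ?thesis
      using eq(2) assms(2) by (auto simp: stable_matrix_def eigenvalue_of_def)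
  qed
qed

section \<open>Semidefinite forms and completion of the square\<close>

lemma inner_transpose_mult: "x \<bullet> (transpose A *v y) = (A *v x) \<bullet> (y :: real^'n)"
  by (metis dot_lmul_matrix inner_commute transpose_matrix_vector)

lemma transpose_add: "transpose (A + B) = transpose A + transpose B"
  by (simp add: transpose_def vec_eq_iff)

lemma psd_matrix_add: "psd_matrix A \<Longrightarrow> psd_matrix B \<Longrightarrow> psd_matrix (A + B)"
  by (simp add: psd_matrix_def transpose_add matrix_vector_mult_add_rdistrib inner_add_right)

lemma pd_matrix_add_psd: "pd_matrix A \<Longrightarrow> psd_matrix B \<Longrightarrow> pd_matrix (A + B)"
  by (simp add: pd_matrix_def psd_matrix_def transpose_add matrix_vector_mult_add_rdistrib
      inner_add_right add_pos_nonneg)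

lemma pd_imp_psd_matrix: "pd_matrix A \<Longrightarrow> psd_matrix A"
  unfolding pd_matrix_def psd_matrix_def
  by (metis inner_zero_left less_eq_real_def)

lemma inner_congruence:
  fixes P :: "real^'n^'n" and M :: "real^'m^'n"
  shows "x \<bullet> ((transpose M ** P ** M) *v x) = (M *v x) \<bullet> (P *v (M *v x))"
  by (simp add: inner_transpose_mult flip: matrix_vector_mul_assoc del: transpose_matrix_vector)

lemma psd_matrix_congruence: "psd_matrix P \<Longrightarrow> psd_matrix (transpose M ** P ** M)"
  by (simp add: psd_matrix_def inner_congruence matrix_transpose_mul matrix_mul_assoc)

text \<open>Moving from \<open>x\<close> a small step \<open>t\<close> along - W x would make the
  form negative, because its linear term in \<open>t\<close> is -2 |W x|^2.\<close>

lemma psd_matrix_form_eq_0: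
  assumes W: "psd_matrix W" and "x \<bullet> (W *v x) = 0"
  shows "W *v x = 0"
proof (rule ccontr)
  let ?y = "W *v x"
  define c where "c = ?y \<bullet> (W *v ?y)"
  \<comment> \<open>Small enough that t c <= |W x|^2; the added 1 covers c = 0.\<close>
  define t where "t = (?y \<bullet> ?y) / (c + 1)"
  assume "?y \<noteq> 0"
  then have n: "?y \<bullet> ?y > 0"
    by simp
  have c: "c \<ge> 0"
    using W by (simp add: c_def psd_matrix_def)
  have t: "t > 0"
    using n c by (simp add: t_def)
  have "x \<bullet> (W *v ?y) = ?y \<bullet> ?y"
    using W by (metis inner_transpose_mult psd_matrix_def)
  then have "(x - t *\<^sub>R ?y) \<bullet> (W *v (x - t *\<^sub>R ?y)) = t * (t * c - 2 * (?y \<bullet> ?y))"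
    using assms(2)
    by (simp add: c_def matrix_vector_mult_diff_distrib matrix_vector_mult_scaleR algebra_simps)
  moreover have "0 \<le> (x - t *\<^sub>R ?y) \<bullet> (W *v (x - t *\<^sub>R ?y))"
    using W by (simp add: psd_matrix_def)
  ultimately have "0 \<le> t * c - 2 * (?y \<bullet> ?y)"
    using t by (simp add: zero_le_mult_iff)
  moreover have "t * c \<le> ?y \<bullet> ?y"
    using n c by (simp add: t_def field_simps)
  ultimately show False
    using n by linarith
qed

lemma pd_matrix_mult_inv:
  assumes "pd_matrix G"
  shows "G *v (matrix_inv G *v y) = y"
proof -
  have "G *v x = 0 \<Longrightarrow> x = 0" for x
    using assms by (metis inner_zero_right less_irrefl pd_matrix_def)
  then have "invertible G"
    by (simp add: invertible_left_inverse matrix_left_invertible_ker)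
  then have "G ** matrix_inv G = mat 1"
    unfolding invertible_def matrix_inv_def by (rule someI2_ex) blast
  then show ?thesis
    by (simp add: matrix_vector_mul_assoc)
qed

lemma matrix_add_rdistrib:
  fixes C :: "'a::semiring_1^'p^'n"
  shows "(A + B) ** C = A ** C + B ** C"
  by (simp add: vec_eq_iff matrix_matrix_mult_def distrib_right sum.distrib)

lemma matrix_vector_mult_uminus: "(- A) *v x = - (A *v (x :: 'a::ring_1^'n))"
  by (simp add: vec_eq_iff matrix_vector_mult_def sum_negf)

text \<open>The input u = K x minimizes (F x + B u)' W (F x + B u) + u' R u, and the left side is
  the minimum. The lemma thus turns a Riccati right-hand side into a closed-loop energy.\<close>

lemma riccati_completion:
  fixes F W :: "real^'n^'n" and B :: "real^'m^'n"
  assumes W: "psd_matrix W" and R: "pd_matrix R"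
    and G: "G = R + transpose B ** W ** B" and Y: "Y = transpose B ** W ** F"
    and K: "K = - (matrix_inv G ** Y)"
  shows "x \<bullet> ((transpose F ** W ** F - transpose Y ** matrix_inv G ** Y) *v x) =
    ((F + B ** K) *v x) \<bullet> (W *v ((F + B ** K) *v x)) + (K *v x) \<bullet> (R *v (K *v x))"
proof -
  define f u where "f = F *v x" and "u = K *v x"
  have u: "u = - (matrix_inv G *v (Y *v x))"
    unfolding u_def K matrix_vector_mult_uminus matrix_vector_mul_assoc[symmetric] ..
  have Yx: "Y *v x = transpose B *v (W *v f)"
    by (simp only: Y f_def flip: matrix_vector_mul_assoc)
  have "pd_matrix G"
    unfolding G by (intro pd_matrix_add_psd R psd_matrix_congruence W)
  \<comment> \<open>Stationarity in \<open>u\<close>; paired with \<open>u\<close>, it reduces the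
    quadratic terms in \<open>u\<close> to a cross term.\<close>
  then have "G *v u = - (transpose B *v (W *v f))"
    using pd_matrix_mult_inv[of G "Y *v x"] by (simp add: u Yx vec.neg)
  then have "u \<bullet> (G *v u) = - ((B *v u) \<bullet> (W *v f))"
    by (simp add: inner_transpose_mult del: transpose_matrix_vector)
  moreover have "u \<bullet> (G *v u) = u \<bullet> (R *v u) + (B *v u) \<bullet> (W *v (B *v u))"
    by (simp add: G matrix_vector_mult_add_rdistrib inner_add_right inner_congruence)
  moreover have "(Y *v x) \<bullet> u = f \<bullet> (W *v (B *v u))"
    using W unfolding Yx psd_matrix_def by (metis inner_commute inner_transpose_mult)
  moreover have "(F + B ** K) *v x = f + B *v u"
    by (simp only: f_def u_def matrix_vector_mult_add_rdistrib matrix_vector_mul_assoc)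
  moreover have "(Y *v x) \<bullet> (matrix_inv G *v (Y *v x)) = - ((Y *v x) \<bullet> u)"
    by (simp add: u)
  ultimately show ?thesis
    by (simp add: matrix_vector_mult_diff_rdistrib inner_diff_right inner_congruence
        matrix_vector_right_distrib inner_add_left inner_add_right flip: f_def u_def)
qed

section \<open>A Lyapunov criterion with an observability condition\<close>

text \<open>For an eigenvector a + i b with eigenvalue |c| >= 1, \<open>F\<close> multiplies the
  joint \<open>P\<close>-energy of \<open>a\<close> and \<open>b\<close> by |c|^2, whereas
  \<open>decrease\<close> lowers it by w a + w b. So \<open>w\<close> vanishes at both, and likewise
  along their orbits, which forces a = b = 0.\<close>

lemma stable_matrix_lyapunov:
  fixes F P :: "real^'n^'n"
  assumes P: "pd_matrix P"
    and decrease: "\<And>x. x \<bullet> (P *v x) = (F *v x) \<bullet> (P *v (F *v x)) + w x"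
    and w: "\<And>x. 0 \<le> w x"
    and observable: "\<And>x. (\<And>k. w (((*v) F ^^ k) x) = 0) \<Longrightarrow> x = 0"
  shows "stable_matrix F"
  unfolding stable_matrix_def eigenvalue_of_def
proof (intro allI impI, elim exE conjE, rule ccontr)
  fix c v
  assume v: "v \<noteq> 0" "map_matrix complex_of_real F *v v = c *s v" and "\<not> cmod c < 1"
  then have c: "1 \<le> (Re c)\<^sup>2 + (Im c)\<^sup>2"
    by (simp add: cmod_def not_less)
  \<comment> \<open>The relation between the real part \<open>a\<close> and the imaginary part \<open>b\<close> of an eigenvector; it is
    preserved when \<open>F\<close> acts on both.\<close>
  define rotated where "rotated a b \<longleftrightarrow>
    F *v a = Re c *\<^sub>R a - Im c *\<^sub>R b \<and> F *v b = Im c *\<^sub>R a + Re c *\<^sub>R b" for a b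
  have w_0: "w a = 0 \<and> w b = 0" if "rotated a b" for a b
  proof -
    have PP: "a \<bullet> (P *v b) = b \<bullet> (P *v a)"
      using P unfolding pd_matrix_def by (metis inner_commute inner_transpose_mult)
    have "(F *v a) \<bullet> (P *v (F *v a)) + (F *v b) \<bullet> (P *v (F *v b)) =
        ((Re c)\<^sup>2 + (Im c)\<^sup>2) * (a \<bullet> (P *v a) + b \<bullet> (P *v b))"
      unfolding conjunct1[OF that[unfolded rotated_def]] conjunct2[OF that[unfolded rotated_def]]
      by (simp add: matrix_vector_mult_diff_distrib matrix_vector_right_distrib
          matrix_vector_mult_scaleR algebra_simps PP power2_eq_square)
    moreover have "0 \<le> a \<bullet> (P *v a) + b \<bullet> (P *v b)"
      using pd_imp_psd_matrix[OF P] by (simp add: psd_matrix_def)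
    ultimately have "a \<bullet> (P *v a) + b \<bullet> (P *v b) \<le>
        (F *v a) \<bullet> (P *v (F *v a)) + (F *v b) \<bullet> (P *v (F *v b))"
      using c by (metis mult_1 mult_right_mono)
    then show ?thesis
      using decrease[of a] decrease[of b] w[of a] w[of b] by linarith
  qed
  have rotated_step: "rotated (F *v a) (F *v b)" if "rotated a b" for a b
    using that unfolding rotated_def
    by (metis matrix_vector_mult_diff_distrib matrix_vector_right_distrib
        matrix_vector_mult_scaleR)
  define a b where "a = (\<chi> i. Re (v $ i))" and "b = (\<chi> i. Im (v $ i))"
  have "(\<Sum>j\<in>UNIV. complex_of_real (F $ i $ j) * v $ j) = c * v $ i" for i
    using v(2) by (simp add: vec_eq_iff matrix_vector_mult_def map_matrix_def)
  from arg_cong[OF this, of Re] arg_cong[OF this, of Im] have "rotated a b"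
    by (simp add: rotated_def a_def b_def vec_eq_iff matrix_vector_mult_def algebra_simps)
  then have "rotated (((*v) F ^^ k) a) (((*v) F ^^ k) b)" for k
    by (induction k) (simp_all add: rotated_step)
  then have "a = 0" "b = 0"
    using w_0 by (blast intro: observable)+
  then have "v = 0"
    by (simp add: a_def b_def vec_eq_iff complex_eq_iff)
  with v(1) show False
    by blast
qed

section \<open>Costs along summable trajectories\<close>

text \<open>A sequence with summable norms is bounded, so one of the two factors of the form is
  absorbed into a constant.\<close>

lemma summable_quadratic_form:
  fixes Q :: "real^'n^'n"
  assumes "summable (\<lambda>k. norm (z k))"
  shows "summable (\<lambda>k. z k \<bullet> (Q *v z k))"
proof -
  obtain C where C: "\<And>x. norm (Q *v x) \<le> norm x * C"
    using linear_bounded_pos[OF matrix_vector_mul_linear] by (metis mult.commute)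
  obtain D where D: "\<And>k. norm (z k) \<le> D"
    using summable_imp_Bseq[OF assms] by (auto simp: Bseq_def)
  show ?thesis
  proof (rule summable_comparison_test')
    show "summable (\<lambda>k. norm (z k) * (D * \<bar>C\<bar>))"
      using assms by (rule summable_mult2)
    fix k
    have "norm (z k \<bullet> (Q *v z k)) \<le> norm (z k) * norm (Q *v z k)"
      by (simp add: Cauchy_Schwarz_ineq2)
    also have "norm (Q *v z k) \<le> norm (z k) * \<bar>C\<bar>"
      using C[of "z k"] by (meson abs_ge_self mult_left_mono norm_ge_zero order_trans)
    also have "\<dots> \<le> D * \<bar>C\<bar>"
      using D by (simp add: mult_right_mono)
    finally show "norm (z k \<bullet> (Q *v z k)) \<le> norm (z k) * (D * \<bar>C\<bar>)"
      by (simp add: mult_left_mono)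
  qed
qed

lemma summable_norm_matrix_vector_mult:
  fixes K :: "real^'n^'m"
  assumes "summable (\<lambda>k. norm (z k))"
  shows "summable (\<lambda>k. norm (K *v z k))"
proof -
  obtain C where "\<And>x. norm (K *v x) \<le> C * norm x"
    using linear_bounded_pos[OF matrix_vector_mul_linear] by metis
  then show ?thesis
    using assms by (intro summable_comparison_test'[OF summable_mult[OF assms, of C]]) simp
qed

lemma cost_tail:
  assumes "summable (\<lambda>k. norm (x k))" "summable (\<lambda>k. norm (u k))" "summable (\<lambda>k. norm (v k))"
  shows "convergent (\<lambda>M. cost Q Ra Rb x u v N M)"
    and "(\<lambda>N. cost_inf Q Ra Rb x u v N) \<longlonglongrightarrow> 0"
proof -
  define g where "g k = x k \<bullet> (Q *v x k) + u k \<bullet> (Ra *v u k) + v k \<bullet> (Rb *v v k)" for k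
  have g: "summable g"
    unfolding g_def by (intro summable_add summable_quadratic_form assms)
  have lim: "(\<lambda>M. cost Q Ra Rb x u v N M) \<longlonglongrightarrow> (\<Sum>k. g (k + N))" for N
  proof (rule Lim_transform_eventually)
    show "(\<lambda>M. (\<Sum>k\<le>M. g k) - (\<Sum>k<N. g k)) \<longlonglongrightarrow> (\<Sum>k. g (k + N))"
      unfolding suminf_minus_initial_segment[OF g]
      by (intro tendsto_diff tendsto_const summable_LIMSEQ' g)
    \<comment> \<open>For M < N the cost is an empty sum and the identity can fail, hence the
      eventual equality.\<close>
    have "(\<Sum>k\<le>M. g k) - (\<Sum>k<N. g k) = (\<Sum>k=N..M. g k)" if "N \<le> M" for M
    proof -
      have "{..M} = {..<N} \<union> {N..M}"
        using that by auto
      then show ?thesis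
        by (simp add: sum.union_disjoint ivl_disj_int)
    qed
    then show "\<forall>\<^sub>F M in sequentially.
        (\<Sum>k\<le>M. g k) - (\<Sum>k<N. g k) = cost Q Ra Rb x u v N M"
      unfolding cost_def g_def by (intro eventually_sequentiallyI[of N])
  qed
  then show "convergent (\<lambda>M. cost Q Ra Rb x u v N M)"
    by (rule convergentI)
  have "cost_inf Q Ra Rb x u v N = (\<Sum>k. g (k + N))" for N
    unfolding cost_inf_def by (rule limI) (rule lim)
  then show "(\<lambda>N. cost_inf Q Ra Rb x u v N) \<longlonglongrightarrow> 0"
    using suminf_exist_split2[OF g] by simp
qed

section \<open>The closed loop of the Stackelberg game\<close>

theorem theorem4:
  fixes A :: "real^'n^'n"
    and B1 :: "real^'m1^'n" and B2 :: "real^'m2^'n"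
    and H1 :: "real^'n^'s1" and H2 :: "real^'n^'s2"
    and Q1 Q2 :: "real^'n^'n"
    and R11 R21 :: "real^'m1^'m1" and R12 R22 :: "real^'m2^'m2"
    and P1 P2 :: "real^'n^'n"
    and K1 :: "real^'n^'m1" and K2 :: "real^'n^'m2"
    and L1 :: "real^'s1^'n" and L2 :: "real^'s2^'n"
    and \<Gamma>1 :: "real^'m1^'m1" and \<Gamma>2 :: "real^'m2^'m2"
    and S :: "real^'n^'m1" and M1 :: "real^'n^'n"
    and Y1 :: "real^'n^'m1" and Y2 :: "real^'n^'m2"
    and x xh1 xh2 :: "nat \<Rightarrow> real^'n"
    and u1 :: "nat \<Rightarrow> real^'m1" and u2 :: "nat \<Rightarrow> real^'m2"
    and y1 :: "nat \<Rightarrow> real^'s1" and y2 :: "nat \<Rightarrow> real^'s2"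
  assumes weights: "psd_matrix Q1" "psd_matrix Q2" "psd_matrix R12" "psd_matrix R21"
      "pd_matrix R11" "pd_matrix R22"
    and P_pd: "pd_matrix P1" "pd_matrix P2"
    and \<Gamma>1: "\<Gamma>1 = R11 + transpose B1 ** P1 ** B1"
    and S: "S = matrix_inv \<Gamma>1 ** transpose B1 ** P1"
    and M1: "M1 = mat 1 - B1 ** S"
    and \<Gamma>2: "\<Gamma>2 = R22 + transpose B2 ** transpose M1 ** P2 ** M1 ** B2
                + transpose B2 ** transpose S ** R21 ** S ** B2"
    and Y1: "Y1 = transpose B1 ** P1 ** A + transpose B1 ** P1 ** B2 ** K2"
    and Y2: "Y2 = transpose B2 ** transpose M1 ** P2 ** M1 ** A
                + transpose B2 ** transpose S ** R21 ** S ** A"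
    and K1: "K1 = - (matrix_inv \<Gamma>1 ** Y1)"
    and K2: "K2 = - (matrix_inv \<Gamma>2 ** Y2)"
    and riccati1: "P1 = Q1 + transpose (A + B2 ** K2) ** P1 ** (A + B2 ** K2)
                - transpose Y1 ** matrix_inv \<Gamma>1 ** Y1 + transpose K2 ** R12 ** K2"
    and riccati2: "P2 = Q2 + transpose A ** transpose M1 ** P2 ** M1 ** A
                + transpose A ** transpose S ** R21 ** S ** A
                - transpose Y2 ** matrix_inv \<Gamma>2 ** Y2"
    and stabilizable: "stabilizable A (hcat B1 B2)"
    and observable: "observable A Q1" "observable A Q2"
    and stable: "stable_matrix (block_matrix
                (A + B2 ** K2 - L1 ** H1)  (- (B2 ** K2))
                (- (B1 ** K1))             (A + B1 ** K1 - L2 ** H2))"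
    and state: "\<And>k. x (Suc k) = A *v x k + B1 *v u1 k + B2 *v u2 k"
    and measurements: "\<And>k. y1 k = H1 *v x k" "\<And>k. y2 k = H2 *v x k"
    and observer1: "\<And>k. xh1 (Suc k) = A *v xh1 k + B1 *v u1 k + B2 *v (K2 *v xh1 k)
                + L1 *v (y1 k - H1 *v xh1 k)"
    and observer2: "\<And>k. xh2 (Suc k) = A *v xh2 k + B1 *v (K1 *v xh2 k) + B2 *v u2 k
                + L2 *v (y2 k - H2 *v xh2 k)"
    and strategy: "\<And>k. u1 k = K1 *v xh1 k" "\<And>k. u2 k = K2 *v xh2 k"
  shows "\<forall>\<epsilon>>0. \<exists>N0. \<forall>N\<ge>N0.
      convergent (\<lambda>M. cost Q1 R11 R12 x u1 u2 N M) \<and>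
      cost_inf Q1 R11 R12 x u1 u2 N - x N \<bullet> (P1 *v x N) < \<epsilon> \<and>
      convergent (\<lambda>M. cost Q2 R21 R22 x u1 u2 N M) \<and>
      cost_inf Q2 R21 R22 x u1 u2 N - x N \<bullet> (P2 *v x N) < \<epsilon>"
proof -
  define G F where "G = A + B2 ** K2" and "F = A + B1 ** K1 + B2 ** K2"
  \<comment> \<open>\<open>W\<close> is the leader's effective weight on y = A x + B2 u2: the
    follower replies with - S y, which moves the state to M1 y and costs the leader the
    \<open>R21\<close> form of S y.\<close>
  define W where "W = transpose M1 ** P2 ** M1 + transpose S ** R21 ** S"
  note P_psd = P_pd[THEN pd_imp_psd_matrix]
  have Y1_G: "Y1 = transpose B1 ** P1 ** G"
    by (simp add: Y1 G_def matrix_add_ldistrib matrix_mul_assoc)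
  have F_G: "F = G + B1 ** K1"
    by (simp add: F_def G_def)
  \<comment> \<open>With the leader playing \<open>K2\<close>, the follower's reply to G z is K1 z,
    so \<open>M1\<close> carries G z to the closed-loop state F z.\<close>
  have "K1 = - (S ** G)"
    by (simp add: K1 S Y1_G matrix_mul_assoc)
  then have S_G: "S *v (G *v z) = - (K1 *v z)" for z
    by (simp add: matrix_vector_mul_assoc matrix_vector_mult_uminus)
  have M1_G: "M1 *v (G *v z) = F *v z" for z
    by (simp add: M1 F_G matrix_vector_mult_diff_rdistrib matrix_vector_mult_add_rdistrib S_G
        vec.neg flip: matrix_vector_mul_assoc)
  have W_psd: "psd_matrix W"
    unfolding W_def by (intro psd_matrix_add psd_matrix_congruence P_psd weights)
  have W_G: "(G *v z) \<bullet> (W *v (G *v z)) =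
      (F *v z) \<bullet> (P2 *v (F *v z)) + (K1 *v z) \<bullet> (R21 *v (K1 *v z))" for z
    by (simp add: W_def matrix_vector_mult_add_rdistrib inner_add_right inner_congruence M1_G S_G
        vec.neg)
  have lyapunov1: "z \<bullet> (P1 *v z) = (F *v z) \<bullet> (P1 *v (F *v z)) + (z \<bullet> (Q1 *v z) +
      (K1 *v z) \<bullet> (R11 *v (K1 *v z)) + (K2 *v z) \<bullet> (R12 *v (K2 *v z)))" for z
  proof -
    have "P1 = Q1 + (transpose G ** P1 ** G - transpose Y1 ** matrix_inv \<Gamma>1 ** Y1) +
        transpose K2 ** R12 ** K2"
      using riccati1 by (simp add: G_def algebra_simps)
    from arg_cong[OF this, of "\<lambda>X. z \<bullet> (X *v z)"]
      riccati_completion[OF P_psd(1) weights(5) \<Gamma>1 Y1_G K1, of z]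
    show ?thesis
      by (simp only: matrix_vector_mult_add_rdistrib[of _ _ z] inner_add_right inner_congruence F_G)
  qed
  have lyapunov2: "z \<bullet> (P2 *v z) = (F *v z) \<bullet> (P2 *v (F *v z)) + (z \<bullet> (Q2 *v z) +
      (K1 *v z) \<bullet> (R21 *v (K1 *v z)) + (K2 *v z) \<bullet> (R22 *v (K2 *v z)))" for z
  proof -
    \<comment> \<open>In terms of \<open>W\<close>, the leader's equation is a standard Riccati
      equation for \<open>A\<close> and \<open>B2\<close>. Completion leaves the
      \<open>W\<close>-energy of G z, which \<open>W_G\<close> resolves into the energies of F z and
      K1 z.\<close>
    have \<Gamma>2_W: "\<Gamma>2 = R22 + transpose B2 ** W ** B2"
      by (simp add: \<Gamma>2 W_def matrix_add_ldistrib matrix_add_rdistrib matrix_mul_assoc)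
    have Y2_W: "Y2 = transpose B2 ** W ** A"
      by (simp add: Y2 W_def matrix_add_ldistrib matrix_add_rdistrib matrix_mul_assoc)
    have "P2 = Q2 + (transpose A ** W ** A - transpose Y2 ** matrix_inv \<Gamma>2 ** Y2)"
      using riccati2
      by (simp add: W_def matrix_add_ldistrib matrix_add_rdistrib matrix_mul_assoc algebra_simps)
    from arg_cong[OF this, of "\<lambda>X. z \<bullet> (X *v z)"]
      riccati_completion[OF W_psd weights(6) \<Gamma>2_W Y2_W K2, of z] W_G[of z]
    show ?thesis
      by (simp add: matrix_vector_mult_add_rdistrib[of Q2] inner_add_right flip: G_def)
  qed
  have F_stable: "stable_matrix F"
  proof (rule stable_matrix_lyapunov)
    \<comment> \<open>The sum of both players' stage costs under ideal feedback.\<close>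
    define w where "w z = z \<bullet> (Q1 *v z) + (K1 *v z) \<bullet> (R11 *v (K1 *v z)) +
      (K2 *v z) \<bullet> (R12 *v (K2 *v z)) + (z \<bullet> (Q2 *v z) + (K1 *v z) \<bullet> (R21 *v (K1 *v z)) +
      (K2 *v z) \<bullet> (R22 *v (K2 *v z)))" for z
    note nonneg = weights(1-4)[unfolded psd_matrix_def, THEN conjunct2, rule_format]
      weights(5,6)[THEN pd_imp_psd_matrix, unfolded psd_matrix_def, THEN conjunct2, rule_format]
    show "pd_matrix (P1 + P2)"
      by (intro pd_matrix_add_psd P_pd P_psd)
    show "z \<bullet> ((P1 + P2) *v z) = (F *v z) \<bullet> ((P1 + P2) *v (F *v z)) + w z" for z
      using lyapunov1[of z] lyapunov2[of z]
      by (simp add: w_def matrix_vector_mult_add_rdistrib inner_add_right)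
    show "0 \<le> w z" for z
      unfolding w_def by (intro add_nonneg_nonneg nonneg)
    \<comment> \<open>All summands are nonnegative, so each vanishes; \<open>R11\<close> from the
      follower's cost and \<open>R22\<close> from the leader's are definite and annihilate both
      inputs.\<close>
    have w_0: "K1 *v z = 0 \<and> K2 *v z = 0 \<and> Q1 *v z = 0" if "w z = 0" for z
    proof -
      have "z \<bullet> (Q1 *v z) = 0 \<and> (K1 *v z) \<bullet> (R11 *v (K1 *v z)) = 0 \<and>
          (K2 *v z) \<bullet> (R22 *v (K2 *v z)) = 0"
        using that nonneg(1,2)[of z] nonneg(4,5)[of "K1 *v z"] nonneg(3,6)[of "K2 *v z"]
        unfolding w_def by linarith
      then show ?thesis
        using weights(5,6) psd_matrix_form_eq_0[OF weights(1)]
        unfolding pd_matrix_def by (metis less_irrefl)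
    qed
    show "z = 0" if z: "\<And>k. w (((*v) F ^^ k) z) = 0" for z
    proof -
      \<comment> \<open>Without inputs \<open>F\<close> acts as \<open>A\<close>, so the
        \<open>F\<close>-orbit of \<open>z\<close> is its \<open>A\<close>-orbit, with zero outputs
        under \<open>Q1\<close>; observability compares it with the orbit of 0.\<close>
      have F_A: "F *v y = A *v y" if "K1 *v y = 0" "K2 *v y = 0" for y
        using that
        by (simp add: F_def matrix_vector_mult_add_rdistrib flip: matrix_vector_mul_assoc)
      have orbit: "((*v) A ^^ k) z = ((*v) F ^^ k) z" for k
      proof (induction k)
        case (Suc k)
        show ?case
          using F_A[of "((*v) F ^^ k) z"] w_0[OF z[of k]] by (simp add: Suc)
      qed simp
      have "((*v) A ^^ k) 0 = 0" for k
        by (induction k) simp_all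
      then have "Q1 *v (((*v) A ^^ k) z) = Q1 *v (((*v) A ^^ k) 0)" for k
        using w_0[OF z[of k]] by (simp add: orbit)
      then show ?thesis
        using observable(1) unfolding observable_def by blast
    qed
  qed
  define e1 e2 where "e1 k = x k - xh1 k" and "e2 k = x k - xh2 k" for k
  define Z where "Z k = vjoin (x k) (vjoin (e1 k) (e2 k))" for k
  have u: "u1 k = K1 *v (x k - e1 k)" "u2 k = K2 *v (x k - e2 k)" for k
    by (simp_all add: strategy e1_def e2_def)
  \<comment> \<open>The first observer assumes K2 xh1 while K2 xh2 is applied. The mismatch is K2
    (e1 - e2), and symmetrically for the second observer. The errors therefore evolve without
    \<open>x\<close>, which gives the zero block.\<close>
  have "Z (Suc k) = block_matrix F (hcat (- (B1 ** K1)) (- (B2 ** K2))) 0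
      (block_matrix (A + B2 ** K2 - L1 ** H1) (- (B2 ** K2))
        (- (B1 ** K1)) (A + B1 ** K1 - L2 ** H2)) *v Z k" for k
    by (simp add: Z_def block_matrix_mult_vjoin hcat_mult_vjoin F_def e1_def e2_def state
        observer1 observer2 measurements strategy matrix_vector_mult_add_rdistrib
        matrix_vector_mult_diff_rdistrib matrix_vector_mult_uminus matrix_vector_mult_diff_distrib
        algebra_simps flip: matrix_vector_mul_assoc)
  then have Z: "summable (\<lambda>k. norm (Z k))"
    by (rule summable_norm_stable_orbit[OF stable_matrix_block_triangular[OF F_stable stable]])
  have x: "summable (\<lambda>k. norm (x k))"
    using Z by (rule summable_comparison_test'[where N = 0]) (simp add: Z_def norm_vjoin_ge)
  have "norm (e1 k) \<le> norm (Z k)" "norm (e2 k) \<le> norm (Z k)" for k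
    unfolding Z_def
    by (rule order_trans[OF norm_vjoin_ge(1) norm_vjoin_ge(2)],
        rule order_trans[OF norm_vjoin_ge(2) norm_vjoin_ge(2)])
  then have e: "summable (\<lambda>k. norm (e1 k))" "summable (\<lambda>k. norm (e2 k))"
    by (auto intro: summable_comparison_test'[OF Z, where N = 0])
  have "summable (\<lambda>k. norm (x k - e1 k))" "summable (\<lambda>k. norm (x k - e2 k))"
    by (rule summable_comparison_test'[OF summable_add[OF x e(1)], where N = 0]
        summable_comparison_test'[OF summable_add[OF x e(2)], where N = 0],
        simp add: norm_triangle_ineq4)+
  then have u_sum: "summable (\<lambda>k. norm (u1 k))" "summable (\<lambda>k. norm (u2 k))"
    unfolding u by (auto intro: summable_norm_matrix_vector_mult)
  show ?thesis
  proof (intro allI impI)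
    fix \<epsilon> :: real
    assume "\<epsilon> > 0"
    then have "\<forall>\<^sub>F N in sequentially. cost_inf Q1 R11 R12 x u1 u2 N < \<epsilon> \<and>
        cost_inf Q2 R21 R22 x u1 u2 N < \<epsilon>"
      by (intro eventually_conj order_tendstoD(2)[OF cost_tail(2)[OF x u_sum]])
    then obtain N0 where N0: "\<And>N. N \<ge> N0 \<Longrightarrow> cost_inf Q1 R11 R12 x u1 u2 N < \<epsilon> \<and>
        cost_inf Q2 R21 R22 x u1 u2 N < \<epsilon>"
      unfolding eventually_sequentially by blast
    \<comment> \<open>Dropping the subtracted forms bounds both differences by the cost tails
      alone.\<close>
    have "0 \<le> x N \<bullet> (P1 *v x N)" "0 \<le> x N \<bullet> (P2 *v x N)" for N
      using P_psd by (simp_all add: psd_matrix_def)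
    then show "\<exists>N0. \<forall>N\<ge>N0.
        convergent (\<lambda>M. cost Q1 R11 R12 x u1 u2 N M) \<and>
        cost_inf Q1 R11 R12 x u1 u2 N - x N \<bullet> (P1 *v x N) < \<epsilon> \<and>
        convergent (\<lambda>M. cost Q2 R21 R22 x u1 u2 N M) \<and>
        cost_inf Q2 R21 R22 x u1 u2 N - x N \<bullet> (P2 *v x N) < \<epsilon>"
      using N0 cost_tail(1)[OF x u_sum]
      by (intro exI[of _ N0]) (smt (verit))
  qed
qed

end
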